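(* Let $u<v$ be real numbers and let $f\colon[u,v]_{\mathbb{Q}}\to\mathbb{R}$ be a function whose derivative $f'\colon[u,v]_{\mathbb{Q}}\to\mathbb{R}$ is defined on all of $[u,v]_{\mathbb{Q}}$, is uniform and is uniformly continuous. Then $$(\mathbb{Q})\int_u^v f'=f(v)-f(u),$$ where $f(u),f(v)$ are extended values.
   Context: For reals $u\le v$, $[u,v]_{\mathbb{Q}}=\{a\in\mathbb{Q}\mid u\le a\le v\}$. For $M\subset\mathbb{Q}$, $g\colon M\to\mathbb{R}$ is uniformly continuous (UC) if for every $k\in\mathbb{N}$ there is $l\in\mathbb{N}$ with $a,b\in M$, $|a-b|\le 1/l\Rightarrow |g(a)-g(b)|\le 1/k$; for UC $g$ and real $x$ that is a limit of elements of $M$, $g(x):=\lim g(a_n)$ for any sequence $(a_n)$ in $M$ with $a_n\to x$ (the limit exists and is independent of the sequence). Derivative: for $a\in M$ a limit point of $M$, $f'(a)=y$ if for every $k$ there is $l$ with $b\in M$, $0<|a-b|\le1/l\Rightarrow|\frac{f(b)-f(a)}{b-a}-y|\le 1/k$; it is uniform on $N$ if $l$ can be chosen independently of $a\in N$. Integral: a tagged partition of $[u,v]_{\mathbb{Q}}$ is a tuple of reals $u=u_0<u_1<\dots<u_n=v$ with rationals $b_i\in[u_{i-1},u_i]_{\mathbb{Q}}$; its norm is $\max_i(u_i-u_{i-1})$, its Riemann sum for $g$ is $\sum_i g(b_i)(u_i-u_{i-1})$. $(\mathbb{Q})\int_u^v g$ is the limit $\lim_n R(g,P_n)$ if it exists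 for every sequence $(P_n)$ of tagged partitions with norms tending to $0$ (it is then independent of the sequence). *)

theory Defs
  imports Complex_Main
begin

definition rat_Icc :: "real \<Rightarrow> real \<Rightarrow> rat set" where
  "rat_Icc u v = {a. u \<le> of_rat a \<and> of_rat a \<le> v}"

text \<open>A function \<open>M \<rightarrow> \<real>\<close> with \<open>M \<subseteq> \<rat>\<close> is represented by a total function on \<^typ>\<open>rat\<close>;
  every notion below depends only on its values on \<open>M\<close>. The positivity guards on \<open>k\<close> and \<open>l\<close>
  are needed because \<open>1 / 0 = 0\<close>.\<close>

definition UC_on :: "rat set \<Rightarrow> (rat \<Rightarrow> real) \<Rightarrow> bool" where
  "UC_on M g \<longleftrightarrow>
     (\<forall>k::nat. 0 < k \<longrightarrow> (\<exists>l::nat. 0 < l \<and>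
        (\<forall>a\<in>M. \<forall>b\<in>M. \<bar>a - b\<bar> \<le> 1 / of_nat l \<longrightarrow> \<bar>g a - g b\<bar> \<le> 1 / real k)))"

text \<open>Meaningful only if \<open>UC_on M g\<close> holds and \<open>x\<close> is a limit of elements of \<open>M\<close>.\<close>

definition ext_value :: "rat set \<Rightarrow> (rat \<Rightarrow> real) \<Rightarrow> real \<Rightarrow> real" where
  "ext_value M g x =
     (THE y. \<forall>a :: nat \<Rightarrow> rat. (\<forall>n. a n \<in> M) \<and> (\<lambda>n. of_rat (a n)) \<longlonglongrightarrow> x
        \<longrightarrow> (\<lambda>n. g (a n)) \<longlonglongrightarrow> y)"

definition rat_limit_point :: "rat set \<Rightarrow> rat \<Rightarrow> bool" where
  "rat_limit_point M a \<longleftrightarrow>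
     (\<forall>l::nat. 0 < l \<longrightarrow> (\<exists>b\<in>M. 0 < \<bar>a - b\<bar> \<and> \<bar>a - b\<bar> \<le> 1 / of_nat l))"

definition has_rat_derivative :: "rat set \<Rightarrow> (rat \<Rightarrow> real) \<Rightarrow> rat \<Rightarrow> real \<Rightarrow> bool" where
  "has_rat_derivative M f a y \<longleftrightarrow> a \<in> M \<and> rat_limit_point M a \<and>
     (\<forall>k::nat. 0 < k \<longrightarrow> (\<exists>l::nat. 0 < l \<and>
        (\<forall>b\<in>M. 0 < \<bar>a - b\<bar> \<and> \<bar>a - b\<bar> \<le> 1 / of_nat l
           \<longrightarrow> \<bar>(f b - f a) / of_rat (b - a) - y\<bar> \<le> 1 / real k)))"

definition uniform_rat_derivative_on ::
    "rat set \<Rightarrow> rat set \<Rightarrow> (rat \<Rightarrow> real) \<Rightarrow> (rat \<Rightarrow> real) \<Rightarrow> bool" where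
  "uniform_rat_derivative_on N M f f' \<longleftrightarrow>
     (\<forall>k::nat. 0 < k \<longrightarrow> (\<exists>l::nat. 0 < l \<and>
        (\<forall>a\<in>N. \<forall>b\<in>M. 0 < \<bar>a - b\<bar> \<and> \<bar>a - b\<bar> \<le> 1 / of_nat l
           \<longrightarrow> \<bar>(f b - f a) / of_rat (b - a) - f' a\<bar> \<le> 1 / real k)))"

text \<open>A triple \<open>(n, p, b)\<close> encodes the division points \<open>p 0 < \<dots> < p n\<close> and the tags
  \<open>b 1, \<dots>, b n\<close>; values of \<open>p\<close> and \<open>b\<close> at other indices are irrelevant.\<close>

type_synonym rat_partition = "nat \<times> (nat \<Rightarrow> real) \<times> (nat \<Rightarrow> rat)"

fun is_tagged_partition :: "real \<Rightarrow> real \<Rightarrow> rat_partition \<Rightarrow> bool" where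
  "is_tagged_partition u v (n, p, b) \<longleftrightarrow> 0 < n \<and> p 0 = u \<and> p n = v \<and>
     (\<forall>i\<in>{1..n}. p (i - 1) < p i \<and> b i \<in> rat_Icc (p (i - 1)) (p i))"

fun partition_norm :: "rat_partition \<Rightarrow> real" where
  "partition_norm (n, p, b) = Max ((\<lambda>i. p i - p (i - 1)) ` {1..n})"

fun riemann_sum :: "(rat \<Rightarrow> real) \<Rightarrow> rat_partition \<Rightarrow> real" where
  "riemann_sum g (n, p, b) = (\<Sum>i = 1..n. g (b i) * (p i - p (i - 1)))"

definition has_rat_integral :: "(rat \<Rightarrow> real) \<Rightarrow> real \<Rightarrow> real \<Rightarrow> real \<Rightarrow> bool" where
  "has_rat_integral g u v I \<longleftrightarrow>
     (\<forall>P :: nat \<Rightarrow> rat_partition.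
        (\<forall>n. is_tagged_partition u v (P n)) \<and> (\<lambda>n. partition_norm (P n)) \<longlonglongrightarrow> 0
          \<longrightarrow> (\<lambda>n. riemann_sum g (P n)) \<longlonglongrightarrow> I)"

end

theory Submission imports Defs begin

text \<open>Multiplying out the difference quotient, uniform differentiability says that
  \<open>\<bar>f b - f a - f' a * (b - a)\<bar> \<le> e * \<bar>b - a\<bar>\<close> whenever \<open>a\<close> and \<open>b\<close> are close. As \<open>f'\<close> is
  uniformly continuous on a bounded set, it is bounded, so this estimate makes \<open>f\<close> uniformly
  continuous, and it survives the passage to the extended values of \<open>f\<close> in the argument \<open>b\<close>.
  Applying it with \<open>a\<close> the tag and \<open>b\<close> each endpoint of one interval \<open>[p, q]\<close> of a fine tagged
  partition gives an error of at most \<open>e * (q - p)\<close> between the increment of the extended \<open>f\<close>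
  and the corresponding term of the Riemann sum; the increments telescope and the errors add
  up to at most \<open>e * (v - u)\<close>.\<close>

section \<open>Real-number forms of uniform continuity and uniform differentiability\<close>

lemma abs_rat_diff_le_iff:
  "\<bar>a - b\<bar> \<le> 1 / of_nat l \<longleftrightarrow> \<bar>real_of_rat a - real_of_rat b\<bar> \<le> 1 / real l"
proof -
  have "\<bar>a - b\<bar> \<le> 1 / of_nat l \<longleftrightarrow> real_of_rat \<bar>a - b\<bar> \<le> real_of_rat (1 / of_nat l)"
    by (simp only: of_rat_less_eq)
  also have "real_of_rat \<bar>a - b\<bar> = \<bar>real_of_rat a - real_of_rat b\<bar>"
    by (simp add: of_rat_diff of_rat_less abs_if)
  also have "real_of_rat (1 / of_nat l) = 1 / real l"
    by (simp add: of_rat_divide)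
  finally show ?thesis .
qed

lemma ex_inverse_nat_le:
  fixes e :: real
  assumes "0 < e"
  shows "\<exists>k::nat. 0 < k \<and> 1 / real k \<le> e"
proof -
  obtain n where "inverse (real (Suc n)) < e"
    using reals_Archimedean[OF assms] by blast
  then show ?thesis
    by (intro exI[of _ "Suc n"]) (simp add: inverse_eq_divide)
qed

text \<open>By the Archimedean property, reciprocals of positive naturals and positive reals are
  interchangeable as bounds.\<close>

lemma UC_on_iff:
  "UC_on M g \<longleftrightarrow> (\<forall>e>0. \<exists>d>0. \<forall>a\<in>M. \<forall>b\<in>M.
     \<bar>real_of_rat a - real_of_rat b\<bar> \<le> d \<longrightarrow> \<bar>g a - g b\<bar> \<le> e)"
proof
  assume UC: "UC_on M g"
  show "\<forall>e>0. \<exists>d>0. \<forall>a\<in>M. \<forall>b\<in>M.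
     \<bar>real_of_rat a - real_of_rat b\<bar> \<le> d \<longrightarrow> \<bar>g a - g b\<bar> \<le> e"
  proof (intro allI impI)
    fix e :: real
    assume "0 < e"
    then obtain k :: nat where k: "0 < k" "1 / real k \<le> e"
      using ex_inverse_nat_le by blast
    then obtain l :: nat where l: "0 < l"
      "\<forall>a\<in>M. \<forall>b\<in>M. \<bar>a - b\<bar> \<le> 1 / of_nat l \<longrightarrow> \<bar>g a - g b\<bar> \<le> 1 / real k"
      using UC unfolding UC_on_def by blast
    show "\<exists>d>0. \<forall>a\<in>M. \<forall>b\<in>M.
        \<bar>real_of_rat a - real_of_rat b\<bar> \<le> d \<longrightarrow> \<bar>g a - g b\<bar> \<le> e"
      using l k(2) order_trans unfolding abs_rat_diff_le_iff
      by (intro exI[of _ "1 / real l"]) (simp, blast)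
  qed
next
  assume R: "\<forall>e>0. \<exists>d>0. \<forall>a\<in>M. \<forall>b\<in>M.
     \<bar>real_of_rat a - real_of_rat b\<bar> \<le> d \<longrightarrow> \<bar>g a - g b\<bar> \<le> e"
  show "UC_on M g"
    unfolding UC_on_def
  proof (intro allI impI)
    fix k :: nat
    assume "0 < k"
    then obtain d where d: "0 < d" "\<forall>a\<in>M. \<forall>b\<in>M.
        \<bar>real_of_rat a - real_of_rat b\<bar> \<le> d \<longrightarrow> \<bar>g a - g b\<bar> \<le> 1 / real k"
      using R by (metis of_nat_0_less_iff zero_less_divide_1_iff)
    obtain l :: nat where "0 < l" "1 / real l \<le> d"
      using ex_inverse_nat_le[OF d(1)] by blast
    with d(2) show "\<exists>l::nat. 0 < l \<and>
        (\<forall>a\<in>M. \<forall>b\<in>M. \<bar>a - b\<bar> \<le> 1 / of_nat l \<longrightarrow> \<bar>g a - g b\<bar> \<le> 1 / real k)"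
      unfolding abs_rat_diff_le_iff by (meson order_trans)
  qed
qed

text \<open>Clearing the denominator makes the case \<open>a = b\<close> trivially true, and the
  resulting non-strict bound has no quotient left to obstruct a limit in \<open>b\<close>.\<close>

lemma uniform_rat_derivative_onD:
  assumes "uniform_rat_derivative_on N M f f'" and "0 < e"
  shows "\<exists>d>0. \<forall>a\<in>N. \<forall>b\<in>M. \<bar>real_of_rat b - real_of_rat a\<bar> \<le> d \<longrightarrow>
    \<bar>f b - f a - f' a * (real_of_rat b - real_of_rat a)\<bar> \<le> e * \<bar>real_of_rat b - real_of_rat a\<bar>"
proof -
  obtain k :: nat where k: "0 < k" "1 / real k \<le> e"
    using ex_inverse_nat_le assms(2) by blast
  then obtain l :: nat where l: "0 < l"
    "\<forall>a\<in>N. \<forall>b\<in>M. 0 < \<bar>a - b\<bar> \<and> \<bar>a - b\<bar> \<le> 1 / of_nat l \<longrightarrow>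
      \<bar>(f b - f a) / of_rat (b - a) - f' a\<bar> \<le> 1 / real k"
    using assms(1) unfolding uniform_rat_derivative_on_def by blast
  have "\<bar>f b - f a - f' a * (real_of_rat b - real_of_rat a)\<bar>
      \<le> e * \<bar>real_of_rat b - real_of_rat a\<bar>"
    if ab: "a \<in> N" "b \<in> M" "\<bar>real_of_rat b - real_of_rat a\<bar> \<le> 1 / real l" for a b
  proof (cases "a = b")
    case False
    define h where "h = real_of_rat b - real_of_rat a"
    have h: "h \<noteq> 0" using False by (simp add: h_def)
    have "\<bar>a - b\<bar> \<le> 1 / of_nat l"
      using ab(3) by (simp add: abs_rat_diff_le_iff abs_minus_commute)
    then have "\<bar>(f b - f a) / h - f' a\<bar> \<le> e"
      using bspec[OF bspec[OF l(2) ab(1)] ab(2)] False k(2) by (simp add: h_def of_rat_diff)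
    then have "\<bar>(f b - f a) / h - f' a\<bar> * \<bar>h\<bar> \<le> e * \<bar>h\<bar>"
      by (rule mult_right_mono) simp
    moreover have "f b - f a - f' a * h = ((f b - f a) / h - f' a) * h"
      using h by (simp add: field_simps)
    ultimately show ?thesis
      by (simp add: h_def abs_mult)
  qed simp
  with l(1) show ?thesis
    by (intro exI[of _ "1 / real l"]) auto
qed

section \<open>Boundedness of the derivative and uniform continuity of \<open>f\<close>\<close>

text \<open>Finitely many cells of length \<open>d\<close> cover the interval, and within one cell
  \<open>g\<close> varies by at most 1, so the values at one representative per cell control all
  others.\<close>

lemma UC_on_rat_Icc_bounded:
  assumes "UC_on (rat_Icc u v) g"
  shows "\<exists>B. \<forall>a\<in>rat_Icc u v. \<bar>g a\<bar> \<le> B"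
proof -
  let ?M = "rat_Icc u v"
  obtain d where d: "0 < d" "\<And>a b. a \<in> ?M \<Longrightarrow> b \<in> ?M \<Longrightarrow>
      \<bar>real_of_rat a - real_of_rat b\<bar> \<le> d \<Longrightarrow> \<bar>g a - g b\<bar> \<le> 1"
    using assms unfolding UC_on_iff by (metis zero_less_one)
  define cell where "cell a = \<lfloor>real_of_rat a / d\<rfloor>" for a
  \<comment> \<open>For a cell that misses \<open>?M\<close> the choice is arbitrary; this only adds
    a nonnegative term to the bounding sum below.\<close>
  define rep where "rep j = (SOME a. a \<in> ?M \<and> cell a = j)" for j
  define J where "J = {\<lfloor>u / d\<rfloor>..\<lfloor>v / d\<rfloor>}"
  have "\<bar>g a\<bar> \<le> 1 + (\<Sum>j\<in>J. \<bar>g (rep j)\<bar>)" if a: "a \<in> ?M" for a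
  proof -
    let ?b = "rep (cell a)"
    have "?b \<in> ?M \<and> cell ?b = cell a"
      unfolding rep_def by (rule someI[of _ a]) (simp add: a)
    then have b: "?b \<in> ?M" "cell ?b = cell a" by auto
    have "\<bar>real_of_rat a / d - real_of_rat ?b / d\<bar> \<le> 1"
      using b(2) unfolding cell_def by linarith
    then have "\<bar>real_of_rat a - real_of_rat ?b\<bar> \<le> d"
      using d(1) by (simp add: abs_le_iff field_simps)
    then have "\<bar>g a - g ?b\<bar> \<le> 1"
      using d(2) a b(1) by blast
    moreover have "cell a \<in> J"
      using a d(1) by (auto simp: J_def cell_def rat_Icc_def intro!: floor_mono divide_right_mono)
    then have "\<bar>g ?b\<bar> \<le> (\<Sum>j\<in>J. \<bar>g (rep j)\<bar>)"
      by (intro member_le_sum[of _ _ "\<lambda>j. \<bar>g (rep j)\<bar>"]) (auto simp: J_def)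
    ultimately show ?thesis by linarith
  qed
  then show ?thesis by blast
qed

text \<open>At distances up to some \<open>d\<close>, \<open>f\<close> satisfies a Lipschitz
  estimate whose constant comes from the bound on \<open>f'\<close>.\<close>

lemma uniform_rat_derivative_on_imp_UC_on:
  assumes deriv: "uniform_rat_derivative_on M M f f'"
    and bound: "\<And>a. a \<in> M \<Longrightarrow> \<bar>f' a\<bar> \<le> B"
  shows "UC_on M f"
  unfolding UC_on_iff
proof (intro allI impI)
  fix e :: real
  assume e: "0 < e"
  obtain d where d: "0 < d" "\<And>a b. a \<in> M \<Longrightarrow> b \<in> M \<Longrightarrow> \<bar>real_of_rat b - real_of_rat a\<bar> \<le> d \<Longrightarrow>
    \<bar>f b - f a - f' a * (real_of_rat b - real_of_rat a)\<bar> \<le> 1 * \<bar>real_of_rat b - real_of_rat a\<bar>"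
    using uniform_rat_derivative_onD[OF deriv, of 1] by (metis zero_less_one)
  \<comment> \<open>The summand 1 is the error of the linear approximation; the absolute value keeps
    \<open>L\<close> positive even when \<open>M\<close> is empty and \<open>B\<close> is
    negative.\<close>
  define L where "L = \<bar>B\<bar> + 1"
  have L: "0 < L" by (simp add: L_def)
  have "\<bar>f b - f a\<bar> \<le> e"
    if ab: "a \<in> M" "b \<in> M" "\<bar>real_of_rat b - real_of_rat a\<bar> \<le> min d (e / L)" for a b
  proof -
    define h where "h = real_of_rat b - real_of_rat a"
    have h: "\<bar>h\<bar> \<le> d" "\<bar>h\<bar> \<le> e / L"
      using ab(3) by (simp_all add: h_def)
    have "\<bar>f b - f a - f' a * h\<bar> \<le> \<bar>h\<bar>"
      using d(2)[OF ab(1,2)] h(1) by (simp add: h_def)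
    moreover have "\<bar>f' a * h\<bar> \<le> \<bar>B\<bar> * \<bar>h\<bar>"
      using bound[OF ab(1)] by (simp add: abs_mult mult_right_mono)
    ultimately have "\<bar>f b - f a\<bar> \<le> L * \<bar>h\<bar>"
      by (simp add: L_def algebra_simps)
    also have "\<dots> \<le> e"
      using h(2) L by (simp add: field_simps)
    finally show ?thesis .
  qed
  then show "\<exists>d>0. \<forall>a\<in>M. \<forall>b\<in>M. \<bar>real_of_rat a - real_of_rat b\<bar> \<le> d \<longrightarrow> \<bar>f a - f b\<bar> \<le> e"
    using d(1) e L by (intro exI[of _ "min d (e / L)"]) auto
qed

section \<open>Extended values\<close>

text \<open>This is what makes the extended value independent of the approximating sequence.\<close>

lemma UC_on_diff_tendsto_0:
  assumes UC: "UC_on M g"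
    and a: "\<And>n. a n \<in> M" "(\<lambda>n. real_of_rat (a n)) \<longlonglongrightarrow> x"
    and b: "\<And>n. b n \<in> M" "(\<lambda>n. real_of_rat (b n)) \<longlonglongrightarrow> x"
  shows "(\<lambda>n. g (a n) - g (b n)) \<longlonglongrightarrow> 0"
proof (rule LIMSEQ_I)
  fix r :: real
  assume "0 < r"
  \<comment> \<open>Halving \<open>r\<close> turns the non-strict bound of \<open>UC_on_iff\<close>
    into the strict one that the limit criterion demands.\<close>
  then obtain d where d: "0 < d" "\<And>a b. a \<in> M \<Longrightarrow> b \<in> M \<Longrightarrow>
      \<bar>real_of_rat a - real_of_rat b\<bar> \<le> d \<Longrightarrow> \<bar>g a - g b\<bar> \<le> r / 2"
    using UC unfolding UC_on_iff by (metis half_gt_zero)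
  have "(\<lambda>n. real_of_rat (a n) - real_of_rat (b n)) \<longlonglongrightarrow> 0"
    using tendsto_diff[OF a(2) b(2)] by simp
  then obtain n0 where "\<And>n. n \<ge> n0 \<Longrightarrow> \<bar>real_of_rat (a n) - real_of_rat (b n)\<bar> < d"
    using LIMSEQ_D[OF _ d(1)] by fastforce
  then have "\<bar>g (a n) - g (b n)\<bar> < r" if "n \<ge> n0" for n
    using d(2)[OF a(1) b(1), of n n] that \<open>0 < r\<close> by fastforce
  then show "\<exists>n0. \<forall>n\<ge>n0. norm (g (a n) - g (b n) - 0) < r"
    by auto
qed

text \<open>Uniformly continuous maps preserve Cauchy sequences, and the reals are complete.\<close>

lemma UC_on_convergent:
  assumes UC: "UC_on M g"
    and a: "\<And>n. a n \<in> M" "(\<lambda>n. real_of_rat (a n)) \<longlonglongrightarrow> x"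
  shows "convergent (\<lambda>n. g (a n))"
proof (rule Cauchy_convergent, rule CauchyI)
  fix e :: real
  assume "0 < e"
  then obtain d where d: "0 < d" "\<And>a b. a \<in> M \<Longrightarrow> b \<in> M \<Longrightarrow>
      \<bar>real_of_rat a - real_of_rat b\<bar> \<le> d \<Longrightarrow> \<bar>g a - g b\<bar> \<le> e / 2"
    using UC unfolding UC_on_iff by (metis half_gt_zero)
  have "Cauchy (\<lambda>n. real_of_rat (a n))"
    using a(2) by (rule LIMSEQ_imp_Cauchy)
  then obtain n0 where n0: "\<And>m n. m \<ge> n0 \<Longrightarrow> n \<ge> n0 \<Longrightarrow>
      \<bar>real_of_rat (a m) - real_of_rat (a n)\<bar> < d"
    using CauchyD[OF _ d(1)] by (metis real_norm_def)
  have "\<bar>g (a m) - g (a n)\<bar> < e" if "m \<ge> n0" "n \<ge> n0" for m n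
    using d(2)[OF a(1) a(1), of m n] n0[OF that] \<open>0 < e\<close> by linarith
  then show "\<exists>n0. \<forall>m\<ge>n0. \<forall>n\<ge>n0. norm (g (a m) - g (a n)) < e"
    by auto
qed

text \<open>Justifies the description by \<open>THE\<close>: one convergent image sequence supplies
  the limit, and every other sequence shares it.\<close>

lemma ext_value_tendsto:
  assumes UC: "UC_on M g"
    and a: "\<And>n. a n \<in> M" "(\<lambda>n. real_of_rat (a n)) \<longlonglongrightarrow> x"
  shows "(\<lambda>n. g (a n)) \<longlonglongrightarrow> ext_value M g x"
proof -
  let ?lim = "\<lambda>y. \<forall>b :: nat \<Rightarrow> rat. (\<forall>n. b n \<in> M) \<and> (\<lambda>n. of_rat (b n)) \<longlonglongrightarrow> x
        \<longrightarrow> (\<lambda>n. g (b n)) \<longlonglongrightarrow> y"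
  obtain y where y: "(\<lambda>n. g (a n)) \<longlonglongrightarrow> y"
    using UC_on_convergent[OF UC a] by (auto simp: convergent_def)
  have "?lim y"
  proof (intro allI impI)
    fix b :: "nat \<Rightarrow> rat"
    assume "(\<forall>n. b n \<in> M) \<and> (\<lambda>n. of_rat (b n)) \<longlonglongrightarrow> x"
    then have "(\<lambda>n. g (b n) - g (a n)) \<longlonglongrightarrow> 0"
      using UC_on_diff_tendsto_0[OF UC _ _ a] by blast
    from tendsto_add[OF this y] show "(\<lambda>n. g (b n)) \<longlonglongrightarrow> y" by simp
  qed
  \<comment> \<open>The given sequence \<open>a\<close> is essential here: with no sequence tending
    to \<open>x\<close>, every \<open>z\<close> would qualify vacuously.\<close>
  moreover have "z = y" if "?lim z" for z
    using that a y LIMSEQ_unique by blast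
  ultimately have "?lim (ext_value M g x)"
    unfolding ext_value_def by (rule theI)
  with a show ?thesis by blast
qed

lemma rat_Icc_dense:
  assumes "u < v" "x \<in> {u..v}"
  shows "\<exists>a. (\<forall>n. a n \<in> rat_Icc u v) \<and> (\<lambda>n. real_of_rat (a n)) \<longlonglongrightarrow> x"
proof -
  have "\<exists>q. q \<in> rat_Icc u v \<and> \<bar>real_of_rat q - x\<bar> \<le> 1 / real (Suc n)" for n
  proof -
    define h where "h = 1 / real (Suc n)"
    have "0 < h" by (simp add: h_def)
    \<comment> \<open>Since \<open>u < v\<close>, the window around \<open>x\<close> meets the open
      interval even when \<open>x\<close> is an endpoint.\<close>
    then have "max u (x - h) < min v (x + h)"
      using assms by auto
    then obtain q where "max u (x - h) < of_rat q" "of_rat q < min v (x + h)"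
      using of_rat_dense by blast
    then show ?thesis
      by (intro exI[of _ q]) (simp add: rat_Icc_def h_def[symmetric] abs_le_iff del: of_nat_Suc)
  qed
  then obtain a where a: "\<And>n. a n \<in> rat_Icc u v" "\<And>n. \<bar>real_of_rat (a n) - x\<bar> \<le> 1 / real (Suc n)"
    by metis
  have "(\<lambda>n. 1 / real (Suc n)) \<longlonglongrightarrow> 0"
    using LIMSEQ_inverse_real_of_nat by (simp add: inverse_eq_divide)
  then have "(\<lambda>n. real_of_rat (a n) - x) \<longlonglongrightarrow> 0"
    by (rule tendsto_0_le[where K = 1]) (use a(2) in auto)
  then have "(\<lambda>n. real_of_rat (a n)) \<longlonglongrightarrow> x"
    by (simp add: LIM_zero_iff)
  with a(1) show ?thesis by blast
qed

text \<open>Only the second argument becomes real; \<open>a\<close> stays rational because it will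
  be a tag, so \<open>f'\<close> never has to be extended.\<close>

lemma ext_value_linear_approximation:
  assumes "u < v"
    and UC: "UC_on (rat_Icc u v) f"
    and deriv: "uniform_rat_derivative_on (rat_Icc u v) (rat_Icc u v) f f'"
    and "0 < e"
  shows "\<exists>d>0. \<forall>a\<in>rat_Icc u v. \<forall>x\<in>{u..v}. \<bar>x - real_of_rat a\<bar> < d \<longrightarrow>
    \<bar>ext_value (rat_Icc u v) f x - f a - f' a * (x - real_of_rat a)\<bar> \<le> e * \<bar>x - real_of_rat a\<bar>"
proof -
  let ?M = "rat_Icc u v"
  obtain d where d: "0 < d" "\<And>a b. a \<in> ?M \<Longrightarrow> b \<in> ?M \<Longrightarrow> \<bar>real_of_rat b - real_of_rat a\<bar> \<le> d \<Longrightarrow>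
    \<bar>f b - f a - f' a * (real_of_rat b - real_of_rat a)\<bar> \<le> e * \<bar>real_of_rat b - real_of_rat a\<bar>"
    using uniform_rat_derivative_onD[OF deriv \<open>0 < e\<close>] by metis
  have "\<bar>ext_value ?M f x - f a - f' a * (x - real_of_rat a)\<bar> \<le> e * \<bar>x - real_of_rat a\<bar>"
    if a: "a \<in> ?M" and x: "x \<in> {u..v}" and close: "\<bar>x - real_of_rat a\<bar> < d" for a x
  proof -
    obtain b where b: "\<And>n. b n \<in> ?M" "(\<lambda>n. real_of_rat (b n)) \<longlonglongrightarrow> x"
      using rat_Icc_dense[OF \<open>u < v\<close> x] by blast
    have "(\<lambda>n. f (b n)) \<longlonglongrightarrow> ext_value ?M f x"
      by (rule ext_value_tendsto[OF UC b])
    then have lhs: "(\<lambda>n. \<bar>f (b n) - f a - f' a * (real_of_rat (b n) - real_of_rat a)\<bar>)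
        \<longlonglongrightarrow> \<bar>ext_value ?M f x - f a - f' a * (x - real_of_rat a)\<bar>"
      using b(2) by (intro tendsto_intros)
    have dist: "(\<lambda>n. \<bar>real_of_rat (b n) - real_of_rat a\<bar>) \<longlonglongrightarrow> \<bar>x - real_of_rat a\<bar>"
      using b(2) by (intro tendsto_intros)
    have rhs: "(\<lambda>n. e * \<bar>real_of_rat (b n) - real_of_rat a\<bar>) \<longlonglongrightarrow> e * \<bar>x - real_of_rat a\<bar>"
      using dist by (rule tendsto_mult_left)
    \<comment> \<open>Strict closeness of \<open>x\<close> to \<open>a\<close> is an open condition,
      so it passes to the approximating rationals.\<close>
    have "\<forall>\<^sub>F n in sequentially. \<bar>real_of_rat (b n) - real_of_rat a\<bar> < d"
      using order_tendstoD(2)[OF dist close] .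
    then have "\<forall>\<^sub>F n in sequentially. \<bar>f (b n) - f a - f' a * (real_of_rat (b n) - real_of_rat a)\<bar>
        \<le> e * \<bar>real_of_rat (b n) - real_of_rat a\<bar>"
      by eventually_elim (use d(2)[OF a b(1)] in simp)
    then show ?thesis
      by (rule tendsto_le[OF sequentially_bot rhs lhs])
  qed
  with d(1) show ?thesis by blast
qed

section \<open>Tagged partitions and the error of Riemann sums\<close>

lemma tagged_partition_points:
  assumes "is_tagged_partition u v (n, p, b)" and "i \<le> n"
  shows "p i \<in> {u..v}"
proof -
  have step: "p j \<le> p (Suc j)" if "j < n" for j
    using assms(1) that by (force dest: bspec[where x = "Suc j"])
  have mono: "p j \<le> p k" if "j \<le> k" "k \<le> n" for j k
    using that by (induction k rule: dec_induct) (auto intro: order_trans[OF _ step])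
  show ?thesis
    using mono[of 0 i] mono[of i n] assms by simp
qed

text \<open>Each interval contributes an error proportional to its length, so the total does not
  depend on the number of intervals.\<close>

lemma riemann_sum_error:
  assumes part: "is_tagged_partition u v P"
    and norm: "partition_norm P < d"
    and approx: "\<And>a x. a \<in> rat_Icc u v \<Longrightarrow> x \<in> {u..v} \<Longrightarrow> \<bar>x - real_of_rat a\<bar> < d \<Longrightarrow>
      \<bar>F x - f a - g a * (x - real_of_rat a)\<bar> \<le> e * \<bar>x - real_of_rat a\<bar>"
  shows "\<bar>riemann_sum g P - (F v - F u)\<bar> \<le> e * (v - u)"
proof -
  obtain n p b where P: "P = (n, p, b)" by (cases P)
  have ends: "p 0 = u" "p n = v" using part by (auto simp: P)
  have term_error: "\<bar>g (b i) * (p i - p (i - 1)) - (F (p i) - F (p (i - 1)))\<bar> \<le> e * (p i - p (i - 1))"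
    if i: "i \<in> {1..n}" for i
  proof -
    define r where "r = real_of_rat (b i)"
    have tag: "p (i - 1) \<le> r" "r \<le> p i"
      using part i by (auto simp: P rat_Icc_def r_def)
    have pts: "p (i - 1) \<in> {u..v}" "p i \<in> {u..v}"
      by (rule tagged_partition_points[OF part[unfolded P]], use i in force)+
    have "b i \<in> rat_Icc u v"
      using tag pts by (auto simp: rat_Icc_def r_def)
    note approx = approx[OF this, folded r_def]
    have "p i - p (i - 1) \<le> partition_norm P"
      using i by (auto simp: P intro!: Max_ge)
    with norm have len: "p i - p (i - 1) < d" by simp
    \<comment> \<open>In the difference of the two endpoint estimates \<open>f (b i)\<close>
      cancels, and since \<open>r\<close> lies between the endpoints its distances to them add up to
      the interval length.\<close>
    have "\<bar>F (p i) - f (b i) - g (b i) * (p i - r)\<bar> \<le> e * (p i - r)"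
      using approx[OF pts(2)] tag len by simp
    moreover have "\<bar>F (p (i - 1)) - f (b i) - g (b i) * (p (i - 1) - r)\<bar> \<le> e * (r - p (i - 1))"
      using approx[OF pts(1)] tag len by (simp add: abs_of_nonpos)
    ultimately show ?thesis
      unfolding right_diff_distrib by linarith
  qed
  \<comment> \<open>A general \<open>h\<close> serves twice: \<open>F\<close> gives the total
    increment, the identity gives the total length.\<close>
  have telescope: "(\<Sum>i = 1..n. h (p i) - h (p (i - 1))) = h v - h u" for h :: "real \<Rightarrow> real"
    using sum_telescope''[of 0 n "\<lambda>i. h (p i)"] by (simp add: ends)
  have "riemann_sum g P - (F v - F u) =
      (\<Sum>i = 1..n. g (b i) * (p i - p (i - 1)) - (F (p i) - F (p (i - 1))))"
    by (simp only: P riemann_sum.simps telescope[of F, symmetric] sum_subtractf)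
  also have "\<bar>\<dots>\<bar> \<le> (\<Sum>i = 1..n. e * (p i - p (i - 1)))"
    by (rule order_trans[OF sum_abs sum_mono]) (rule term_error)
  also have "\<dots> = e * (v - u)"
    using telescope[of "\<lambda>x. x"] by (simp flip: sum_distrib_left)
  finally show ?thesis .
qed

text \<open>The first conjunct ensures that the extended values in the second are genuine limits and
  not unspecified results of \<open>THE\<close>.\<close>

theorem theorem2p73:
  fixes u v :: real and f f' :: "rat \<Rightarrow> real"
  assumes "u < v"
    and "\<And>a. a \<in> rat_Icc u v \<Longrightarrow> has_rat_derivative (rat_Icc u v) f a (f' a)"
    and "uniform_rat_derivative_on (rat_Icc u v) (rat_Icc u v) f f'"
    and "UC_on (rat_Icc u v) f'"
  shows "UC_on (rat_Icc u v) f \<and>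
    has_rat_integral f' u v (ext_value (rat_Icc u v) f v - ext_value (rat_Icc u v) f u)"
proof
  let ?F = "ext_value (rat_Icc u v) f"
  show UC: "UC_on (rat_Icc u v) f"
    using UC_on_rat_Icc_bounded[OF assms(4)] uniform_rat_derivative_on_imp_UC_on[OF assms(3)]
    by blast
  show "has_rat_integral f' u v (?F v - ?F u)"
    unfolding has_rat_integral_def
  proof (intro allI impI LIMSEQ_I)
    fix P :: "nat \<Rightarrow> rat_partition" and r :: real
    assume P: "(\<forall>n. is_tagged_partition u v (P n)) \<and> (\<lambda>n. partition_norm (P n)) \<longlonglongrightarrow> 0"
      and r: "0 < r"
    \<comment> \<open>The total error \<open>e * (v - u)\<close> becomes \<open>r / 2\<close>,
      strictly below \<open>r\<close>.\<close>
    define e where "e = r / (2 * (v - u))"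
    have e: "0 < e" "e * (v - u) < r"
      using r \<open>u < v\<close> by (simp_all add: e_def field_simps)
    obtain d where d: "0 < d" "\<And>a x. a \<in> rat_Icc u v \<Longrightarrow> x \<in> {u..v} \<Longrightarrow> \<bar>x - real_of_rat a\<bar> < d \<Longrightarrow>
        \<bar>?F x - f a - f' a * (x - real_of_rat a)\<bar> \<le> e * \<bar>x - real_of_rat a\<bar>"
      using ext_value_linear_approximation[OF \<open>u < v\<close> UC assms(3) e(1)] by metis
    obtain n0 where "\<And>n. n \<ge> n0 \<Longrightarrow> partition_norm (P n) < d"
      using order_tendstoD(2)[OF conjunct2[OF P] d(1)] by (auto simp: eventually_sequentially)
    then have "\<bar>riemann_sum f' (P n) - (?F v - ?F u)\<bar> < r" if "n \<ge> n0" for n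
      using riemann_sum_error[OF _ _ d(2), where P = "P n"] P e(2) that by fastforce
    then show "\<exists>n0. \<forall>n\<ge>n0. norm (riemann_sum f' (P n) - (?F v - ?F u)) < r"
      by auto
  qed
qed

end
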